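(* For every integer $m\geq 1$, $$S_{3,0}(2^m)=\begin{cases} 2\cdot 3^{\frac m2-1}, & \text{if } m \text{ is even},\\ 3^{\frac{m-1}{2}}, & \text{if } m \text{ is odd}.\end{cases}$$ Moreover, for integers $m,n$, $$S_{3,0}([2^n,2^n+2^m))=\begin{cases} 3^{\frac m2-1}, & \text{if } m \text{ is even and } 1\leq m\leq n-1,\\ 3^{\frac{m-1}{2}}, & \text{if } m \text{ and } n \text{ are odd and } 1\leq m\leq n-2,\\ 0, & \text{if } m \text{ is odd, } n \text{ is even and } 1\leq m\leq n-1.\end{cases}$$
   Context: For a nonnegative integer $n$, $s(n)$ denotes the sum of the binary digits of $n$. For a nonnegative integer $x$, $$S_{3,0}(x)=\sum_{0\leq n<x,\ n\equiv 0 \pmod 3}(-1)^{s(n)}.$$ For nonnegative integers $y,z$, $S_{3,0}([y,y+z))=S_{3,0}(y+z)-S_{3,0}(y)$. *)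

theory Defs
  imports Main
begin

fun binary_digit_sum :: "nat \<Rightarrow> nat" where
  "binary_digit_sum n = (if n = 0 then 0 else n mod 2 + binary_digit_sum (n div 2))"

text \<open>Left as a simplification rule, the defining equation would rewrite its own right-hand side forever.\<close>
declare binary_digit_sum.simps [simp del]

definition S30 :: "nat \<Rightarrow> int" where
  "S30 x = (\<Sum>n | n < x \<and> n mod 3 = 0. (- 1) ^ binary_digit_sum n)"

text \<open>The arguments are the left endpoint \<open>y\<close> and the length \<open>z\<close> of the interval \<open>[y, y + z)\<close>.\<close>
definition S30_interval :: "nat \<Rightarrow> nat \<Rightarrow> int" where
  "S30_interval y z = S30 (y + z) - S30 y"

end

theory Submission
  imports Defs
begin

text \<open>Write \<open>T a x\<close> for the sum of \<open>(-1)\<^sup>s\<^sup>(\<^sup>i\<^sup>)\<close> over \<open>i < x\<close> with \<open>i \<equiv> -a\<close> modulo 3. The integers in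
  \<open>[2\<^sup>n, 2\<^sup>n + z)\<close>, where \<open>z \<le> 2\<^sup>n\<close>, have one more binary digit 1 than their translates
  in \<open>[0, z)\<close>, so \<open>T a (2\<^sup>n + z) = T a (2\<^sup>n) - T (a + 2\<^sup>n) z\<close>. Taking \<open>z = 2\<^sup>n\<close> gives a linear
  recursion for the vector of the three values \<open>T a (2\<^sup>n)\<close>, which is solved in closed form,
  and \<open>z = 2\<^sup>m\<close> expresses the interval sums through this vector.\<close>

lemma binary_digit_sum_0: "binary_digit_sum 0 = 0"
  using binary_digit_sum.simps[of 0] by (simp only: simp_thms if_True)

lemma binary_digit_sum_rec: "binary_digit_sum n = n mod 2 + binary_digit_sum (n div 2)"
proof (cases "n = 0")
  case True
  then show ?thesis
    by (simp add: binary_digit_sum_0)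
next
  case False
  then show ?thesis
    using binary_digit_sum.simps[of n] by presburger
qed

text \<open>Halving \<open>2 ^ Suc n + k\<close> strips the lowest digit of \<open>k\<close> and
  leaves \<open>2 ^ n + k div 2\<close> with \<open>k div 2 < 2 ^ n\<close>, so the induction
  descends to the leading 1.\<close>

lemma binary_digit_sum_add_power2:
  "k < 2 ^ n \<Longrightarrow> binary_digit_sum (2 ^ n + k) = Suc (binary_digit_sum k)"
proof (induction n arbitrary: k)
  case 0
  then show ?case
    using binary_digit_sum_rec[of 1] by (simp add: binary_digit_sum_0)
next
  case (Suc n)
  have "binary_digit_sum (2 ^ Suc n + k) = k mod 2 + binary_digit_sum (2 ^ n + k div 2)"
    using binary_digit_sum_rec[of "2 ^ Suc n + k"] by simp
  also have "\<dots> = Suc (k mod 2 + binary_digit_sum (k div 2))"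
    using Suc by simp
  also have "k mod 2 + binary_digit_sum (k div 2) = binary_digit_sum k"
    by (rule binary_digit_sum_rec[symmetric])
  finally show ?case .
qed

text \<open>With the class written as \<open>-a\<close>, translating by \<open>2 ^ n\<close> adds
  \<open>2 ^ n\<close> to \<open>a\<close>, which avoids subtraction on \<open>nat\<close>.\<close>

definition T :: "nat \<Rightarrow> nat \<Rightarrow> int" where
  "T a x = (\<Sum>i | i < x \<and> (i + a) mod 3 = 0. (- 1) ^ binary_digit_sum i)"

lemma S30_eq_T: "S30 x = T 0 x"
  by (simp add: S30_def T_def)

lemma T_mod: "T (a mod 3) x = T a x"
  by (simp add: T_def mod_simps)

lemma T_add_power2:
  assumes "z \<le> 2 ^ n"
  shows "T a (2 ^ n + z) = T a (2 ^ n) - T (a + 2 ^ n) z"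
proof -
  let ?f = "\<lambda>i. (- 1 :: int) ^ binary_digit_sum i"
  let ?A = "{i. i < 2 ^ n \<and> (i + a) mod 3 = 0}"
  let ?B = "{i. i < z \<and> (i + (a + 2 ^ n)) mod 3 = 0}"
  have split: "{i. i < 2 ^ n + z \<and> (i + a) mod 3 = 0} = ?A \<union> (+) (2 ^ n) ` ?B"
  proof (intro equalityI subsetI)
    fix i assume i: "i \<in> {i. i < 2 ^ n + z \<and> (i + a) mod 3 = 0}"
    show "i \<in> ?A \<union> (+) (2 ^ n) ` ?B"
    proof (cases "i < 2 ^ n")
      case False
      then obtain k where k: "i = 2 ^ n + k"
        by (metis le_Suc_ex not_less)
      then have "k \<in> ?B"
        using i by (simp add: ac_simps)
      then show ?thesis
        using k by simp
    qed (use i in simp)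
  qed (auto simp: ac_simps)
  have "T a (2 ^ n + z) = sum ?f ?A + sum ?f ((+) (2 ^ n) ` ?B)"
    unfolding T_def split by (rule sum.union_disjoint) auto
  also have "sum ?f ((+) (2 ^ n) ` ?B) = (\<Sum>i\<in>?B. ?f (2 ^ n + i))"
    by (simp add: sum.reindex)
  \<comment> \<open>The bound on \<open>z\<close> gives \<open>i < 2 ^ n\<close>, so the added
    \<open>2 ^ n\<close> is a new leading digit and flips the sign.\<close>
  also have "\<dots> = (\<Sum>i\<in>?B. - ?f i)"
    using assms by (intro sum.cong) (auto simp: binary_digit_sum_add_power2)
  finally show ?thesis
    by (simp add: T_def sum_negf)
qed

lemma T_power2_Suc: "T a (2 ^ Suc n) = T a (2 ^ n) - T (a + 2 ^ n) (2 ^ n)"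
  using T_add_power2[of "2 ^ n" n a] by (simp flip: mult_2)

lemma power2_mod_3: "(2 :: nat) ^ n mod 3 = (if even n then 1 else 2)"
proof (induction n)
  case (Suc n)
  have "(2 :: nat) ^ Suc n mod 3 = 2 * (2 ^ n mod 3) mod 3"
    by (simp only: power_Suc mod_mult_right_eq)
  then show ?case
    using Suc by simp
qed simp

text \<open>Reducing the shifted index to 0, 1 or 2 closes the recursion on three values; the shift
  depends only on the parity of \<open>n\<close>.\<close>

lemma T_add_power2_mod: "T (a + 2 ^ n) x = T ((a + (if even n then 1 else 2)) mod 3) x"
proof -
  have "(a + 2 ^ n) mod 3 = (a + 2 ^ n mod 3) mod 3"
    by (rule mod_add_right_eq[symmetric])
  then have "(a + 2 ^ n) mod 3 = (a + (if even n then 1 else 2)) mod 3"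
    unfolding power2_mod_3 .
  then show ?thesis
    using T_mod[of "a + 2 ^ n" x] by (simp only:)
qed

lemma T_power2_Suc_even:
  assumes "even n"
  shows "T 0 (2 ^ Suc n) = T 0 (2 ^ n) - T 1 (2 ^ n)"
    and "T 1 (2 ^ Suc n) = T 1 (2 ^ n) - T 2 (2 ^ n)"
    and "T 2 (2 ^ Suc n) = T 2 (2 ^ n) - T 0 (2 ^ n)"
  using assms T_power2_Suc[of 0 n] T_power2_Suc[of 1 n] T_power2_Suc[of 2 n]
    T_add_power2_mod[of 0 n] T_add_power2_mod[of 1 n] T_add_power2_mod[of 2 n]
  by (simp_all flip: numeral_2_eq_2)

lemma T_power2_Suc_odd:
  assumes "odd n"
  shows "T 0 (2 ^ Suc n) = T 0 (2 ^ n) - T 2 (2 ^ n)"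
    and "T 1 (2 ^ Suc n) = T 1 (2 ^ n) - T 0 (2 ^ n)"
    and "T 2 (2 ^ Suc n) = T 2 (2 ^ n) - T 1 (2 ^ n)"
  using assms T_power2_Suc[of 0 n] T_power2_Suc[of 1 n] T_power2_Suc[of 2 n]
    T_add_power2_mod[of 0 n] T_add_power2_mod[of 1 n] T_add_power2_mod[of 2 n]
  by (simp_all flip: numeral_2_eq_2)

lemma T_1: "T a 1 = (if a mod 3 = 0 then 1 else 0)"
proof -
  have "i < 1 \<and> (i + a) mod 3 = 0 \<longleftrightarrow> i = 0 \<and> a mod 3 = 0" for i
    by (cases i) simp_all
  then have "T a 1 = (\<Sum>i | i = 0 \<and> a mod 3 = 0. (- 1) ^ binary_digit_sum i)"
    by (simp only: T_def)
  then show ?thesis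
    by (simp only: Collect_conv_if) (simp add: binary_digit_sum_0)
qed

text \<open>One odd step takes (1, 0, -1) to (2, -1, -1), up to the factor \<open>3 ^ k\<close>. The
  conditional form serves both inside the induction for odd exponents and, afterwards, for the even
  closed form.\<close>

lemma T_even_power2_if_odd:
  assumes "T 0 (2 ^ Suc (2 * k)) = 3 ^ k" "T 1 (2 ^ Suc (2 * k)) = 0" "T 2 (2 ^ Suc (2 * k)) = - (3 ^ k)"
  shows "T 0 (2 ^ Suc (Suc (2 * k))) = 2 * 3 ^ k" "T 1 (2 ^ Suc (Suc (2 * k))) = - (3 ^ k)"
    "T 2 (2 ^ Suc (Suc (2 * k))) = - (3 ^ k)"
proof -
  have "odd (Suc (2 * k))"
    by simp
  note rec = T_power2_Suc_odd[OF this, unfolded assms]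
  show "T 0 (2 ^ Suc (Suc (2 * k))) = 2 * 3 ^ k" "T 1 (2 ^ Suc (Suc (2 * k))) = - (3 ^ k)"
    "T 2 (2 ^ Suc (Suc (2 * k))) = - (3 ^ k)"
    unfolding rec by simp_all
qed

text \<open>An odd step followed by an even step multiplies the vector (1, 0, -1) by 3; the even
  step from (1, 0, 0) at \<open>2 ^ 0\<close> produces it.\<close>

lemma T_odd_power2:
  "T 0 (2 ^ Suc (2 * k)) = 3 ^ k" "T 1 (2 ^ Suc (2 * k)) = 0" "T 2 (2 ^ Suc (2 * k)) = - (3 ^ k)"
proof (induction k)
  case 0
  {
    case 1 show ?case using T_power2_Suc_even(1)[of 0] by (simp add: T_1[simplified])
  next
    case 2 show ?case using T_power2_Suc_even(2)[of 0] by (simp add: T_1[simplified])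
  next
    case 3 show ?case using T_power2_Suc_even(3)[of 0] by (simp add: T_1[simplified])
  }
next
  case (Suc k)
  have "even (Suc (Suc (2 * k)))"
    by simp
  note rec = T_power2_Suc_even[OF this, unfolded T_even_power2_if_odd[OF Suc]]
  have double: "2 * Suc k = Suc (Suc (2 * k))"
    by simp
  {
    case 1 show ?case unfolding double rec by simp
  next
    case 2 show ?case unfolding double rec by simp
  next
    case 3 show ?case unfolding double rec by simp
  }
qed

lemmas T_even_power2 = T_even_power2_if_odd[OF T_odd_power2]

text \<open>The term \<open>T 0 (2 ^ n)\<close> cancels, so \<open>n\<close> matters only through
  its parity.\<close>

lemma S30_interval_power2:
  assumes "m \<le> n"
  shows "S30_interval (2 ^ n) (2 ^ m) = - T (if even n then 1 else 2) (2 ^ m)"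
  using T_add_power2[of "2 ^ m" n 0] T_add_power2_mod[of 0 n] assms
  by (simp add: S30_interval_def S30_eq_T)

theorem theorem1:
  "(\<forall>m::nat. 1 \<le> m \<longrightarrow>
      S30 (2 ^ m) = (if even m then 2 * 3 ^ (m div 2 - 1) else 3 ^ ((m - 1) div 2))) \<and>
   (\<forall>m n::nat.
      (even m \<and> 1 \<le> m \<and> m + 1 \<le> n \<longrightarrow>
         S30_interval (2 ^ n) (2 ^ m) = 3 ^ (m div 2 - 1)) \<and>
      (odd m \<and> odd n \<and> 1 \<le> m \<and> m + 2 \<le> n \<longrightarrow>
         S30_interval (2 ^ n) (2 ^ m) = 3 ^ ((m - 1) div 2)) \<and>
      (odd m \<and> even n \<and> 1 \<le> m \<and> m + 1 \<le> n \<longrightarrow>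
         S30_interval (2 ^ n) (2 ^ m) = 0))"
proof -
  \<comment> \<open>The values for indices 1 and 2 agree here, which is why the interval sum for
    even \<open>m\<close> is the same for both parities of \<open>n\<close>.\<close>
  have even_case: "T 0 (2 ^ m) = 2 * 3 ^ (m div 2 - 1) \<and>
      T 1 (2 ^ m) = - (3 ^ (m div 2 - 1)) \<and> T 2 (2 ^ m) = - (3 ^ (m div 2 - 1))"
    if "even m" "1 \<le> m" for m
  proof -
    \<comment> \<open>A positive even \<open>m\<close> is at least 2, so the subtraction does not
      truncate.\<close>
    have "m = Suc (Suc (2 * (m div 2 - 1)))"
      using that by presburger
    then show ?thesis
      using T_even_power2[of "m div 2 - 1"] by metis
  qed
  have odd_case: "T 0 (2 ^ m) = 3 ^ ((m - 1) div 2) \<and>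
      T 1 (2 ^ m) = 0 \<and> T 2 (2 ^ m) = - (3 ^ ((m - 1) div 2))"
    if "odd m" for m
  proof -
    have "m = Suc (2 * ((m - 1) div 2))"
      using that by presburger
    then show ?thesis
      using T_odd_power2[of "(m - 1) div 2"] by metis
  qed
  show ?thesis
    by (simp add: S30_eq_T S30_interval_power2 even_case odd_case del: One_nat_def)
qed

end
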